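(* Let $T^{\mathrm o}=\sum_{\ell\ge0}\sum_{m=-\ell}^{\ell}a^{\mathrm o}_{\ell,m}Y_{\ell,m}$ be a random field in $L_2(\Omega\times\mathbb{S}^2)$, and set $A^{\mathrm o}_\ell:=\big(\sum_{m=-\ell}^{\ell}|a^{\mathrm o}_{\ell,m}|^2\big)^{1/2}$. Let $\varepsilon>0$ and let $(\beta_\ell)_{\ell\ge0}$ be a sequence of positive numbers. Let $\ell^*$ be the smallest integer such that $\sum_{\ell>\ell^*}\mathbb E[(A^{\mathrm o}_\ell)^2]\le\varepsilon^2/4$, and let $\lambda$ satisfy \[ 0\le\lambda<\frac{\varepsilon}{2\sqrt{\sum_{\ell=0}^{\ell^*}\beta_\ell^2}}. \] Let $T^{\mathrm r}=\sum_{\ell,m}a^{\mathrm r}_{\ell,m}Y_{\ell,m}$ be the regularized field whose coefficients (for each realization) minimize $\tfrac12\sum_{\ell,m}|a_{\ell,m}-a^{\mathrm o}_{\ell,m}|^2+\lambda\sum_{\ell}\beta_\ell\big(\sum_{m=-\ell}^{\ell}|a_{\ell,m}|^2\big)^{1/2}$. Then \[ \|T^{\mathrm o}-T^{\mathrm r}\|_{L_2(\Omega\times\mathbb{S}^2)}<\varepsilon. \]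
   Context: Random fields are maps $\Omega\times\mathbb{S}^2\to\mathbb{R}$ on a probability space $(\Omega,\mathcal F,\mathbb P)$, measurable w.r.t. $\mathcal F\otimes\mathcal B(\mathbb{S}^2)$; $L_2(\Omega\times\mathbb{S}^2)$ is the $L_2$ space for $\mathbb P\otimes\sigma$, with norm $\|T\|_{L_2(\Omega\times\mathbb{S}^2)}=\big(\mathbb E\int_{\mathbb{S}^2}|T|^2\,d\sigma\big)^{1/2}$, where $\sigma$ is the surface measure on $\mathbb{S}^2$ with $\sigma(\mathbb{S}^2)=4\pi$. $\{Y_{\ell,m}\}$ is the standard complex orthonormal basis of spherical harmonics and $a^{\mathrm o}_{\ell,m}=\int_{\mathbb{S}^2}T^{\mathrm o}\overline{Y_{\ell,m}}\,d\sigma$. Explicitly, $a^{\mathrm r}_{\ell,m}=(1-\lambda\beta_\ell/A^{\mathrm o}_\ell)a^{\mathrm o}_{\ell,m}$ if $A^{\mathrm o}_\ell>\lambda\beta_\ell$ and $a^{\mathrm r}_{\ell,m}=0$ otherwise. *)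

theory Defs
  imports "HOL-Probability.Probability" "HOL-Computational_Algebra.Polynomial"
begin

text \<open>Surface measure on the unit sphere of R^3, realised as the cone measure:
  sigma(A) = 3 * Lebesgue measure of the cone {t x : 0 < t <= 1, x in A},
  i.e. 3 times the push-forward of Lebesgue measure on the punctured unit ball under
  y -> y / |y|.  Total mass 4 pi.\<close>

definition sphere_measure :: "(real^3) measure" where
  "sphere_measure = scale_measure (3::ennreal)
     (distr (restrict_space lborel (cball 0 1 - {0})) (restrict_space borel (sphere 0 1))
        (\<lambda>y. y /\<^sub>R norm y))"

text \<open>Legendre polynomials via Rodrigues' formula.\<close>
definition legendre_poly :: "nat \<Rightarrow> real poly" where
  "legendre_poly l = smult (1 / (2 ^ l * fact l)) ((pderiv ^^ l) ([:-1, 0, 1:] ^ l))"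

text \<open>For 0 <= m <= l:  Y_{l,m}(x) = N_{l,m} P_l^m(cos theta) e^{i m phi} with the
  Condon-Shortley phase P_l^m(z) = (-1)^m (1-z^2)^{m/2} P_l^{(m)}(z); on the unit sphere
  (sin theta)^m e^{i m phi} = (x1 + i x2)^m and cos theta = x3.\<close>
definition sph_harm_nonneg :: "nat \<Rightarrow> nat \<Rightarrow> real^3 \<Rightarrow> complex" where
  "sph_harm_nonneg l m x =
     complex_of_real (sqrt ((2 * real l + 1) / (4 * pi) * (fact (l - m) / fact (l + m)))
        * (-1) ^ m * poly ((pderiv ^^ m) (legendre_poly l)) (x $ 3))
     * (Complex (x $ 1) (x $ 2)) ^ m"

text \<open>Y_{l,-m} = (-1)^m conj(Y_{l,m}); indices with |m| > l give 0 (never used).\<close>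
definition sph_harm :: "nat \<Rightarrow> int \<Rightarrow> real^3 \<Rightarrow> complex" where
  "sph_harm l m x =
     (if nat \<bar>m\<bar> > l then 0
      else if m \<ge> 0 then sph_harm_nonneg l (nat m) x
      else (-1) ^ nat (- m) * cnj (sph_harm_nonneg l (nat (- m)) x))"

definition field_coeff :: "('w \<Rightarrow> real^3 \<Rightarrow> real) \<Rightarrow> 'w \<Rightarrow> nat \<Rightarrow> int \<Rightarrow> complex" where
  "field_coeff T \<omega> l m =
     integral\<^sup>L sphere_measure (\<lambda>x. complex_of_real (T \<omega> x) * cnj (sph_harm l m x))"

definition band_norm :: "(nat \<Rightarrow> int \<Rightarrow> complex) \<Rightarrow> nat \<Rightarrow> real" where
  "band_norm a l = sqrt (\<Sum>m\<in>{- int l..int l}. (cmod (a l m))\<^sup>2)"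

text \<open>Minimiser of 1/2 sum |a - a^o|^2 + lam sum_l beta_l (sum_m |a_{l,m}|^2)^{1/2}
  (group soft thresholding), in the explicit form given in the paper.\<close>
definition reg_coeff :: "real \<Rightarrow> (nat \<Rightarrow> real) \<Rightarrow> (nat \<Rightarrow> int \<Rightarrow> complex) \<Rightarrow> nat \<Rightarrow> int \<Rightarrow> complex" where
  "reg_coeff lam beta a l m =
     (if band_norm a l > lam * beta l
      then complex_of_real (1 - lam * beta l / band_norm a l) * a l m else 0)"

definition harm_partial_sum :: "(nat \<Rightarrow> int \<Rightarrow> complex) \<Rightarrow> nat \<Rightarrow> real^3 \<Rightarrow> complex" where
  "harm_partial_sum a L x = (\<Sum>l\<le>L. \<Sum>m\<in>{- int l..int l}. a l m * sph_harm l m x)"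

definition L2sq :: "'w measure \<Rightarrow> ('w \<Rightarrow> real^3 \<Rightarrow> complex) \<Rightarrow> ennreal" where
  "L2sq M f = (\<integral>\<^sup>+ z. ennreal ((cmod (f (fst z) (snd z)))\<^sup>2) \<partial>(M \<Otimes>\<^sub>M sphere_measure))"

definition L2norm :: "'w measure \<Rightarrow> ('w \<Rightarrow> real^3 \<Rightarrow> complex) \<Rightarrow> ennreal" where
  "L2norm M f = (if L2sq M f = \<infinity> then \<infinity> else ennreal (sqrt (enn2real (L2sq M f))))"

definition band_tail :: "'w measure \<Rightarrow> ('w \<Rightarrow> real^3 \<Rightarrow> real) \<Rightarrow> nat \<Rightarrow> ennreal" where
  "band_tail M T k =
     (\<Sum>l. if k < l then (\<integral>\<^sup>+ \<omega>. ennreal ((band_norm (field_coeff T \<omega>) l)\<^sup>2) \<partial>M) else 0)"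

end

theory Submission
  imports Defs
begin

text \<open>
  Every band of the error is shrunk by soft thresholding: the degree-\<open>l\<close> part of \<open>To - Tr\<close> has
  norm \<open>min (lam * beta l) A\<^sub>l\<close>. Using the first bound for \<open>l \<le> lstar\<close>, the second one beyond,
  and Parseval, the partial sums of the error have mean square strictly below \<open>\<epsilon>\<^sup>2 / 2\<close>. This leaves
  enough room to pass to the limit with \<open>\<bar>a + b\<bar>\<^sup>2 \<le> 2 \<bar>a\<bar>\<^sup>2 + 2 \<bar>b\<bar>\<^sup>2\<close> in place of Minkowski's inequality.

  Parseval rests on the orthonormality of the spherical harmonics. Different orders are orthogonal
  because a rotation about the third axis multiplies the product by a phase; for equal orders the
  integral reduces to one over \<open>[-1, 1]\<close> by Archimedes' theorem, whose moments follow from rotation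
  invariance alone: comparing the coefficients of \<open>t\<^sup>2\<close> in
  \<open>\<integral>(x\<^sub>3 + t x\<^sub>1)\<^sup>2\<^sup>n d\<sigma> = (1 + t\<^sup>2)\<^sup>n \<integral>x\<^sub>3\<^sup>2\<^sup>n d\<sigma>\<close> gives a recurrence for \<open>\<integral>x\<^sub>3\<^sup>2\<^sup>n d\<sigma>\<close>.
\<close>

section \<open>Legendre polynomials\<close>

text \<open>The integral over \<open>[-1, 1]\<close>, given on coefficients so that integration by parts is pure algebra.\<close>
definition symint :: "real poly \<Rightarrow> real" where
  "symint p = (\<Sum>i\<le>degree p. coeff p i * (1 - (-1) ^ Suc i) / real (Suc i))"

text \<open>Lets the sums for polynomials of different degree run over one common range.\<close>

lemma symint_alt: "degree p \<le> n \<Longrightarrow> symint p = (\<Sum>i\<le>n. coeff p i * (1 - (-1) ^ Suc i) / real (Suc i))"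
  unfolding symint_def by (rule sum.mono_neutral_left) (auto simp: coeff_eq_0)

lemma symint_add: "symint (p + q) = symint p + symint q"
proof -
  let ?n = "max (degree p) (degree q)"
  have "degree (p + q) \<le> ?n" by (simp add: degree_add_le)
  then show ?thesis
    by (subst (1 2 3) symint_alt[where n = ?n]) (auto simp: sum.distrib[symmetric] algebra_simps add_divide_distrib diff_divide_distrib)
qed

lemma symint_smult: "symint (smult c p) = c * symint p"
  by (subst (1 2) symint_alt[where n = "degree p"])
    (auto simp: sum_distrib_left mult.assoc)

lemma symint_0 [simp]: "symint 0 = 0"
  by (simp add: symint_def)

text \<open>Fundamental theorem of calculus: the factor \<open>Suc i\<close> from differentiation
  cancels the denominator, and after the index shift the constant term drops out because
  \<open>1 - (-1) ^ 0 = 0\<close>.\<close>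

lemma symint_pderiv: "symint (pderiv p) = poly p 1 - poly p (-1)"
proof (cases "degree p")
  case 0
  then obtain c where "p = [:c:]" using degree_eq_zeroE by blast
  then show ?thesis by (simp add: pderiv_pCons)
next
  case (Suc n)
  have "symint (pderiv p) = (\<Sum>i\<le>n. coeff p (Suc i) * (1 - (-1) ^ Suc i))"
    using Suc by (subst symint_alt[where n = n]) (auto simp: degree_pderiv coeff_pderiv)
  also have "\<dots> = (\<Sum>i\<le>Suc n. coeff p i * (1 - (-1) ^ i))"
    by (simp add: sum.atMost_Suc_shift del: sum.atMost_Suc)
  also have "\<dots> = poly p 1 - poly p (-1)"
    using Suc by (simp only: poly_altdef flip: sum_subtractf) (simp add: algebra_simps)
  finally show ?thesis .
qed

lemma symint_by_parts:
  assumes "poly (p * q) 1 = 0" "poly (p * q) (-1) = 0"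
  shows "symint (pderiv p * q) = - symint (p * pderiv q)"
proof -
  have "symint (pderiv (p * q)) = 0"
    using assms by (simp only: symint_pderiv)
  then show ?thesis
    by (simp add: pderiv_mult symint_add mult.commute)
qed

section \<open>Endpoint values from Rodrigues' formula\<close>

lemma poly_pderiv_funpow_root:
  fixes q :: "'a :: field_char_0 poly"
  shows "j < n \<Longrightarrow> poly ((pderiv ^^ j) ([:- a, 1:] ^ n * q)) a = 0"
    and "poly ((pderiv ^^ n) ([:- a, 1:] ^ n * q)) a = fact n * poly q a"
proof -
  \<comment> \<open>Differentiation trades one factor \<open>X - a\<close> for a new cofactor, whose
    value at \<open>a\<close> is \<open>Suc n\<close> times that of \<open>q\<close>. Hence
    \<open>q\<close> stays arbitrary in both inductions and derivatives are peeled off from the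
    inside.\<close>
  have step: "pderiv ([:- a, 1:] ^ Suc n * q) = [:- a, 1:] ^ n * (smult (of_nat (Suc n)) q + [:- a, 1:] * pderiv q)" for n q
    by (simp add: pderiv_mult pderiv_power_Suc pderiv_pCons algebra_simps del: power_Suc)
       (simp add: algebra_simps)
  show "j < n \<Longrightarrow> poly ((pderiv ^^ j) ([:- a, 1:] ^ n * q)) a = 0"
  proof (induction j arbitrary: n q)
    case 0
    then show ?case by (simp add: power_0_left)
  next
    case (Suc j)
    then obtain k where k: "n = Suc k" "j < k" by (cases n) auto
    show ?case unfolding k(1) funpow_Suc_right o_def step by (rule Suc.IH[OF k(2)])
  qed
  show "poly ((pderiv ^^ n) ([:- a, 1:] ^ n * q)) a = fact n * poly q a"
  proof (induction n arbitrary: q)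
    case 0
    then show ?case by simp
  next
    case (Suc n)
    show ?case unfolding funpow_Suc_right o_def step Suc.IH by (simp add: algebra_simps)
  qed
qed

text \<open>One factorization for each root of \<open>X^2 - 1\<close>; the second keeps
  \<open>- (- 1)\<close> so that it matches \<open>[:- a, 1:]\<close> at
  \<open>a = -1\<close>.\<close>

lemma Rodrigues_factor:
  "[:-1, 0, 1:] ^ l = [:- 1, 1:] ^ l * [:1, 1 :: real:] ^ l"
  "[:-1, 0, 1:] ^ l = [:- (- 1), 1:] ^ l * [:- 1, 1 :: real:] ^ l"
  by (simp_all flip: power_mult_distrib)

text \<open>Supplies the vanishing boundary terms for repeated integration by parts.\<close>

lemma Rodrigues_root:
  assumes "j < l"
  shows "poly ((pderiv ^^ j) ([:-1, 0, 1:] ^ l)) (1::real) = 0"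
    and "poly ((pderiv ^^ j) ([:-1, 0, 1:] ^ l)) (-1::real) = 0"
  using poly_pderiv_funpow_root(1)[OF assms, of "1::real" "[:1, 1:] ^ l"]
    poly_pderiv_funpow_root(1)[OF assms, of "-1::real" "[:-1, 1:] ^ l"]
  unfolding Rodrigues_factor[symmetric] by blast+

text \<open>At the \<open>l\<close>-fold root 1 the \<open>l\<close>-th derivative equals
  \<open>fact l * 2 ^ l\<close>, exactly the normalizing constant.\<close>

lemma legendre_poly_1: "poly (legendre_poly l) 1 = 1"
  using poly_pderiv_funpow_root(2)[of l "1::real" "[:1, 1:] ^ l"]
  unfolding Rodrigues_factor[symmetric] legendre_poly_def by simp

lemma legendre_poly_minus_1: "poly (legendre_poly l) (-1) = (-1) ^ l"
proof -
  have "poly ((pderiv ^^ l) ([:-1, 0, 1:] ^ l)) (- 1) = fact l * (- 2 :: real) ^ l"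
    using poly_pderiv_funpow_root(2)[of l "-1::real" "[:-1, 1:] ^ l"]
    unfolding Rodrigues_factor(2)[symmetric] by simp
  moreover have "(- 2 :: real) ^ l = (- 1) ^ l * 2 ^ l"
    by (simp flip: power_mult_distrib)
  ultimately show ?thesis
    unfolding legendre_poly_def by (simp only: poly_smult) simp
qed

section \<open>Orthogonality and norms of the Legendre polynomials\<close>

lemma pderiv_funpow_smult: "(pderiv ^^ n) (smult c p) = smult c ((pderiv ^^ n) p)"
  by (induction n) (auto simp: pderiv_smult)

lemma degree_pderiv_funpow: "degree ((pderiv ^^ n) p) = degree p - n" for p :: "real poly"
  by (induction n) (auto simp: degree_pderiv)

lemma degree_legendre_poly: "degree (legendre_poly l) = l"
proof -
  have "degree ([:-1, 0, 1::real:] ^ l) = 2 * l"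
    by (subst degree_power_eq) auto
  then show ?thesis by (simp add: legendre_poly_def degree_pderiv_funpow)
qed

text \<open>Since \<open>j \<le> l\<close>, every boundary term carries a derivative of order below
  \<open>l\<close>, which vanishes at both ends. Each step hands one derivative to \<open>q\<close>,
  so \<open>q\<close> stays arbitrary.\<close>

lemma symint_Rodrigues_by_parts:
  "j \<le> l \<Longrightarrow> symint ((pderiv ^^ j) ([:-1, 0, 1:] ^ l) * q) =
     (-1) ^ j * symint ([:-1, 0, 1:] ^ l * (pderiv ^^ j) q)"
proof (induction j arbitrary: q)
  case 0
  then show ?case by simp
next
  case (Suc j)
  have "symint ((pderiv ^^ Suc j) ([:-1, 0, 1:] ^ l) * q) = - symint ((pderiv ^^ j) ([:-1, 0, 1:] ^ l) * pderiv q)"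
    using Suc.prems by (simp, intro symint_by_parts) (simp_all add: Rodrigues_root)
  also have "\<dots> = - ((-1) ^ j * symint ([:-1, 0, 1:] ^ l * (pderiv ^^ j) (pderiv q)))"
    using Suc by simp
  finally show ?case by (simp add: funpow_swap1)
qed

lemma symint_legendre_poly_lower_degree:
  assumes "degree q < l"
  shows "symint (legendre_poly l * q) = 0"
proof -
  \<comment> \<open>A degree count cannot tell a nonzero constant from 0; stopping one derivative
    early gives a constant, which the last derivative kills.\<close>
  have "(pderiv ^^ (l - 1)) q = [:coeff ((pderiv ^^ (l - 1)) q) 0:]"
    using assms by (intro degree_0_id[symmetric]) (simp add: degree_pderiv_funpow)
  then have "pderiv ((pderiv ^^ (l - 1)) q) = 0"
    by (metis pderiv_singleton)
  moreover have "(pderiv ^^ l) q = pderiv ((pderiv ^^ (l - 1)) q)"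
    using assms by (cases l) auto
  ultimately show ?thesis
    by (simp add: legendre_poly_def symint_smult symint_Rodrigues_by_parts)
qed

text \<open>The Euler operator \<open>X * d/dX\<close> multiplies \<open>X^i\<close> by
  \<open>i\<close>, so subtracting \<open>l * p\<close> cancels the leading term.\<close>

lemma degree_X_pderiv_less:
  fixes p :: "real poly"
  assumes "degree p = l" "l > 0"
  shows "degree ([:0, 1:] * pderiv p - smult (real l) p) < l"
proof -
  have "coeff ([:0, 1:] * pderiv p - smult (real l) p) i = 0" if "i > l - 1" for i
  proof -
    obtain j where j: "i = Suc j" using \<open>i > l - 1\<close> by (cases i) auto
    have "Suc j = l \<or> coeff p (Suc j) = 0"
      using that assms by (cases "Suc j = l") (auto simp: j intro!: coeff_eq_0)
    then show ?thesis by (auto simp: j coeff_pderiv)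
  qed
  then show ?thesis
    by (metis assms(2) degree_le diff_less le_less_trans zero_less_one)
qed

lemma symint_legendre_poly_square:
  "symint (legendre_poly l * legendre_poly l) = 2 / (2 * real l + 1)"
proof (cases "l = 0")
  case True
  then show ?thesis by (simp add: legendre_poly_def symint_def)
next
  case False
  let ?P = "legendre_poly l" and ?X = "[:0, 1:] :: real poly"
  \<comment> \<open>Integrate \<open>(X P\<^sup>2)'\<close>: the leading terms of \<open>X P'\<close> and \<open>l P\<close> cancel, so their difference is orthogonal to \<open>P\<close>.\<close>
  have "symint (pderiv (?X * (?P * ?P))) = 2"
    by (simp add: symint_pderiv legendre_poly_1 legendre_poly_minus_1 power_mult_distrib[symmetric])
  moreover have "pderiv (?X * (?P * ?P)) = smult (2 * real l + 1) (?P * ?P)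
      + smult 2 (?P * (?X * pderiv ?P - smult (real l) ?P))"
    by (rule poly_eq_poly_eq_iff[THEN iffD1], rule ext)
       (simp add: pderiv_mult pderiv_pCons algebra_simps del: mult_pCons_left mult_pCons_right)
  moreover have "symint (?P * (?X * pderiv ?P - smult (real l) ?P)) = 0"
    using False by (intro symint_legendre_poly_lower_degree degree_X_pderiv_less degree_legendre_poly) auto
  ultimately have "(2 * real l + 1) * symint (?P * ?P) = 2"
    by (metis symint_add symint_smult add.right_neutral mult_zero_right)
  then show ?thesis by (simp add: field_simps)
qed

lemma symint_legendre_poly_orthogonal:
  "l \<noteq> k \<Longrightarrow> symint (legendre_poly l * legendre_poly k) = 0"
  using symint_legendre_poly_lower_degree[of "legendre_poly l" k]
    symint_legendre_poly_lower_degree[of "legendre_poly k" l]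
  by (cases "l < k") (auto simp: degree_legendre_poly mult.commute)

section \<open>Associated Legendre functions\<close>

lemma Rodrigues_ode:
  fixes l k :: nat
  defines "v \<equiv> \<lambda>k. (pderiv ^^ k) ([:-1, 0, 1 :: real:] ^ l)"
  shows "[:-1, 0, 1:] * v (Suc (Suc k)) + smult (2 * (real k + 1 - real l)) ([:0, 1:] * v (Suc k))
    + smult ((real k + 1) * (real k - 2 * real l)) (v k) = 0"
proof (induction k)
  have v: "pderiv (v k) = v (Suc k)" for k
    by (simp add: v_def)
  case 0
  \<comment> \<open>First-order equation for \<open>(X^2 - 1)^l\<close>. Its derivative is the case
    \<open>k = 0\<close>, and each induction step is one further differentiation.\<close>
  have "[:-1, 0, 1:] * pderiv (v 0) = smult (2 * real l) ([:0, 1:] * v 0)"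
  proof (cases l)
    case 0
    then show ?thesis by (simp add: v_def)
  next
    case (Suc n)
    have "pderiv (v 0) = smult (real l) ([:-1, 0, 1:] ^ n * [:0, 2:])"
      by (simp add: v_def Suc pderiv_power_Suc pderiv_pCons del: power_Suc) (simp add: algebra_simps)
    then show ?thesis
      by (intro poly_eq_poly_eq_iff[THEN iffD1] ext) (simp add: v_def Suc algebra_simps)
  qed
  from arg_cong[OF this, of pderiv]
  show ?case
    by (simp add: v pderiv_mult pderiv_pCons pderiv_smult poly_eq_poly_eq_iff[symmetric] fun_eq_iff algebra_simps
        del: mult_pCons_left mult_pCons_right)
next
  have v: "pderiv (v k) = v (Suc k)" for k
    by (simp add: v_def)
  case (Suc k)
  from arg_cong[OF Suc, of pderiv]
  show ?case
    by (simp add: v pderiv_mult pderiv_add pderiv_pCons pderiv_smult poly_eq_poly_eq_iff[symmetric] fun_eq_iff algebra_simps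
        del: mult_pCons_left mult_pCons_right)
qed

text \<open>The associated Legendre equation in self-adjoint form, ready for integration by parts:
  expand the derivative and insert \<open>Rodrigues_ode\<close> at order
  \<open>l + m\<close>.\<close>

lemma legendre_poly_ode:
  fixes l m :: nat
  defines "P \<equiv> \<lambda>m. (pderiv ^^ m) (legendre_poly l)"
  shows "pderiv ([:1, 0, -1:] ^ Suc m * P (Suc m)) =
    smult (- ((real l - real m) * (real l + real m + 1))) ([:1, 0, -1:] ^ m * P m)"
proof -
  define c where "c = 1 / (2 ^ l * fact l :: real)"
  define v where "v k = (pderiv ^^ k) ([:-1, 0, 1 :: real:] ^ l)" for k
  have P: "P j = smult c (v (l + j))" for j
    by (simp add: P_def legendre_poly_def pderiv_funpow_smult c_def v_def funpow_add add.commute[of l])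
  have dP: "pderiv (P j) = P (Suc j)" for j
    by (simp add: P_def)
  have ode: "(x * x - 1) * poly (P (Suc (Suc m))) x + 2 * (real m + 1) * (x * poly (P (Suc m)) x)
      + (real l + real m + 1) * (real m - real l) * poly (P m) x = 0" for x
  proof -
    have "poly ([:-1, 0, 1:] * v (Suc (Suc (l + m)))
        + smult (2 * (real (l + m) + 1 - real l)) ([:0, 1:] * v (Suc (l + m)))
        + smult ((real (l + m) + 1) * (real (l + m) - 2 * real l)) (v (l + m))) x = 0"
      unfolding v_def Rodrigues_ode by simp
    then have "c * ((x * x - 1) * poly (v (Suc (Suc (l + m)))) x + 2 * (real m + 1) * (x * poly (v (Suc (l + m))) x)
      + (real l + real m + 1) * (real m - real l) * poly (v (l + m)) x) = 0"
      by (simp add: algebra_simps)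
    then show ?thesis by (simp add: P algebra_simps)
  qed
  have "poly (pderiv ([:1, 0, -1:] ^ Suc m * P (Suc m))) x =
      poly (smult (- ((real l - real m) * (real l + real m + 1))) ([:1, 0, -1:] ^ m * P m)) x" for x
  proof -
    have "poly (pderiv ([:1, 0, -1:] ^ Suc m * P (Suc m))) x =
        - ((1 - x * x) ^ m * ((x * x - 1) * poly (P (Suc (Suc m))) x + 2 * (real m + 1) * (x * poly (P (Suc m)) x)))"
      unfolding pderiv_mult dP pderiv_power_Suc by (simp add: pderiv_pCons algebra_simps del: mult_pCons_left mult_pCons_right)
    also have "\<dots> = - ((1 - x * x) ^ m * (- ((real l + real m + 1) * (real m - real l) * poly (P m) x)))"
      using ode[of x] by (simp only: eq_neg_iff_add_eq_0[symmetric])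
    also have "\<dots> = poly (smult (- ((real l - real m) * (real l + real m + 1))) ([:1, 0, -1:] ^ m * P m)) x"
      by (simp add: algebra_simps)
    finally show ?thesis .
  qed
  then show ?thesis
    by (intro poly_eq_poly_eq_iff[THEN iffD1] ext)
qed

text \<open>Induction on the order. Integration by parts has no boundary terms because
  \<open>1 - X^2\<close> vanishes at both ends, and the self-adjoint equation returns the integral
  of order \<open>m\<close> times the eigenvalue \<open>?c\<close>.\<close>

lemma symint_assoc_legendre:
  assumes "m \<le> l"
  shows "symint ([:1, 0, -1:] ^ m * (pderiv ^^ m) (legendre_poly l) * (pderiv ^^ m) (legendre_poly k)) =
    (if l = k then 2 / (2 * real l + 1) * (fact (l + m) / fact (l - m)) else 0)"
  using assms
proof (induction m)
  case 0
  then show ?case by (simp add: symint_legendre_poly_square symint_legendre_poly_orthogonal)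
next
  case (Suc m)
  let ?P = "\<lambda>m l. (pderiv ^^ m) (legendre_poly l)"
  let ?c = "(real l - real m) * (real l + real m + 1)"
  have "symint ([:1, 0, -1:] ^ Suc m * ?P (Suc m) l * ?P (Suc m) k) =
      - symint (pderiv ([:1, 0, -1:] ^ Suc m * ?P (Suc m) l) * ?P m k)"
    by (subst symint_by_parts) simp_all
  also have "\<dots> = ?c * symint ([:1, 0, -1:] ^ m * ?P m l * ?P m k)"
    unfolding legendre_poly_ode by (simp only: mult_smult_left symint_smult mult_minus_left minus_minus)
  also have "\<dots> = ?c * (if l = k then 2 / (2 * real l + 1) * (fact (l + m) / fact (l - m)) else 0)"
    using Suc by simp
  also have "\<dots> = (if l = k then 2 / (2 * real l + 1) * (?c * (fact (l + m) / fact (l - m))) else 0)"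
    by simp
  \<comment> \<open>The factor \<open>l + m + 1\<close> extends the upper factorial and
    \<open>l - m\<close>, nonzero since \<open>m < l\<close>, cancels the top factor of the lower
    one.\<close>
  also have "?c * (fact (l + m) / fact (l - m)) = fact (l + Suc m) / fact (l - Suc m)"
  proof -
    obtain d where d: "l = m + Suc d" using Suc.prems by (metis less_eq_Suc_le less_imp_Suc_add add_Suc_right)
    then have "fact (l - m) = (real l - real m) * fact (l - Suc m)" "real l - real m \<noteq> 0"
      by simp_all
    then show ?thesis by (simp add: add_ac)
  qed
  finally show ?case .
qed

section \<open>Rotation invariance of the surface measure\<close>

text \<open>Lebesgue measure is determined by its values on boxes; the preimage of a box is its
  image under the orthogonal map \<open>inv f\<close>, which preserves volume.\<close>

lemma emeasure_lborel_orthogonal_vimage: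
  fixes f :: "real^'n::{finite,wellorder} \<Rightarrow> real^'n::_"
  assumes f: "orthogonal_transformation f" and A: "A \<in> sets borel"
  shows "emeasure lborel (f -` A) = emeasure lborel A"
proof -
  have lin: "linear f" and bij: "bij f"
    using f by (auto simp: orthogonal_transformation_linear orthogonal_transformation_bij)
  have meas [measurable]: "f \<in> borel_measurable borel"
    using lin by (intro borel_measurable_continuous_onI linear_continuous_on) (simp add: linear_conv_bounded_linear)
  have inv: "orthogonal_transformation (inv f)"
    using f by (rule orthogonal_transformation_inv)
  have "distr lborel borel f = lborel"
  proof (rule lborel_eqI[symmetric])
    fix l u :: "real^'n::_"
    assume lu: "\<And>b. b \<in> Basis \<Longrightarrow> l \<bullet> b \<le> u \<bullet> b"
    have eq: "f -` box l u = inv f ` box l u"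
      using bij by (simp add: bij_vimage_eq_inv_image)
    have lm: "box l u \<in> lmeasurable" by simp
    have B: "f -` box l u \<in> sets borel"
      using measurable_sets[OF meas, of "box l u"] by simp
    have lm': "f -` box l u \<in> lmeasurable"
      unfolding eq by (rule measurable_orthogonal_image[OF inv lm])
    have "emeasure (distr lborel borel f) (box l u) = emeasure lebesgue (f -` box l u)"
      using B by (simp add: emeasure_distr)
    also have "\<dots> = ennreal (measure lebesgue (f -` box l u))"
      using lm' by (simp add: emeasure_eq_measure2)
    also have "measure lebesgue (f -` box l u) = measure lebesgue (box l u)"
      unfolding eq by (rule measure_orthogonal_image[OF inv lm])
    finally show "emeasure (distr lborel borel f) (box l u) = (\<Prod>b\<in>Basis. (u - l) \<bullet> b)"
      using lu by (simp add: measure_lborel_box)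
  qed simp
  moreover have "emeasure (distr lborel borel f) A = emeasure lborel (f -` A)"
    using A by (simp add: emeasure_distr)
  ultimately show ?thesis by simp
qed

lemma space_sphere_measure [simp]: "space sphere_measure = sphere 0 1"
  by (simp add: sphere_measure_def space_scale_measure space_restrict_space)

lemma sets_sphere_measure [measurable_cong]: "sets sphere_measure = sets (restrict_space borel (sphere 0 1))"
  by (simp add: sphere_measure_def)

text \<open>Reduces surface measure to the volume of the cone over \<open>A\<close>; the cone is
  Borel, so volume invariance applies to it.\<close>

lemma emeasure_sphere_measure:
  assumes "A \<in> sets sphere_measure"
  shows "emeasure sphere_measure A = 3 * emeasure lborel ((cball 0 1 - {0}) \<inter> (\<lambda>y. y /\<^sub>R norm y) -` A)"
    and "(cball 0 1 - {0}) \<inter> (\<lambda>y. y /\<^sub>R norm y) -` A \<in> sets borel"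
proof -
  let ?B = "cball 0 1 - {0} :: (real^3) set"
  have meas: "(\<lambda>y. y /\<^sub>R norm y) \<in> restrict_space lborel ?B \<rightarrow>\<^sub>M restrict_space borel (sphere 0 1)"
    by (intro measurable_restrict_space2) (auto simp: space_restrict_space intro!: measurable_restrict_space1)
  have eq: "(\<lambda>y. y /\<^sub>R norm y) -` A \<inter> space (restrict_space lborel ?B) = ?B \<inter> (\<lambda>y. y /\<^sub>R norm y) -` A"
    by (auto simp: space_restrict_space)
  have A: "A \<in> sets (restrict_space borel (sphere 0 1))"
    using assms by (simp add: sets_sphere_measure)
  from measurable_sets[OF meas A] have *: "?B \<inter> (\<lambda>y. y /\<^sub>R norm y) -` A \<in> sets (restrict_space lborel ?B)"
    by (simp only: eq)
  then show "?B \<inter> (\<lambda>y. y /\<^sub>R norm y) -` A \<in> sets borel"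
    by (subst (asm) sets_restrict_space_iff) auto
  show "emeasure sphere_measure A = 3 * emeasure lborel (?B \<inter> (\<lambda>y. y /\<^sub>R norm y) -` A)"
    unfolding sphere_measure_def
    by (simp only: emeasure_scale_measure emeasure_distr[OF meas A] eq) (subst emeasure_restrict_space, auto)
qed

text \<open>The cone over the whole sphere is the unit ball without its center, a null set, so its
  volume is \<open>4 * pi / 3\<close>.\<close>

lemma emeasure_sphere_measure_sphere: "emeasure sphere_measure (sphere 0 1) = ennreal (4 * pi)"
proof -
  have "emeasure sphere_measure (sphere 0 1) = 3 * emeasure lborel (cball (0::real^3) 1 - {0})"
  proof (subst emeasure_sphere_measure)
    show "sphere 0 1 \<in> sets sphere_measure"
      using sets.top[of sphere_measure] by simp
    have "(cball 0 1 - {0}) \<inter> (\<lambda>y. y /\<^sub>R norm y) -` sphere 0 1 = cball (0::real^3) 1 - {0}" by auto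
    then show "3 * emeasure lborel ((cball (0::real^3) 1 - {0}) \<inter> (\<lambda>y. y /\<^sub>R norm y) -` sphere 0 1) = 3 * emeasure lborel (cball (0::real^3) 1 - {0})" by (simp only:)
  qed
  also have "emeasure lborel (cball (0::real^3) 1 - {0}) = emeasure lborel (cball (0::real^3) 1)"
    by (intro emeasure_Diff_null_set) auto
  also have "3 * \<dots> = ennreal (4 * pi)"
    by (simp add: emeasure_cball eval_unit_ball_vol ennreal_mult'[symmetric] flip: ennreal_numeral)
  finally show ?thesis .
qed

interpretation sphere: finite_measure sphere_measure
  by standard (simp add: emeasure_sphere_measure_sphere)

lemma measurable_sphere_orthogonal:
  assumes "orthogonal_transformation R"
  shows "R \<in> sphere_measure \<rightarrow>\<^sub>M sphere_measure"
proof -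
  have [measurable]: "R \<in> borel_measurable borel"
    using assms by (intro borel_measurable_continuous_onI linear_continuous_on)
      (simp add: orthogonal_transformation_linear flip: linear_conv_bounded_linear)
  have "R \<in> restrict_space borel (sphere 0 1) \<rightarrow>\<^sub>M restrict_space borel (sphere 0 1)"
    using assms by (intro measurable_restrict_space2 measurable_restrict_space1)
      (auto simp: space_restrict_space orthogonal_transformation_norm)
  then show ?thesis
    by (simp cong: measurable_cong_sets add: sets_sphere_measure)
qed

text \<open>An orthogonal map preserves norms and commutes with \<open>y / norm y\<close>, so the
  cone over a preimage is the preimage of the cone.\<close>

lemma distr_sphere_orthogonal:
  assumes R: "orthogonal_transformation R"
  shows "distr sphere_measure sphere_measure R = sphere_measure"
proof (rule measure_eqI)
  fix A assume "A \<in> sets (distr sphere_measure sphere_measure R)"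
  then have A: "A \<in> sets sphere_measure" by simp
  note RA = measurable_sets[OF measurable_sphere_orthogonal[OF R] A]
  let ?C = "\<lambda>A. (cball 0 1 - {0}) \<inter> (\<lambda>y. y /\<^sub>R norm y) -` A"
  have "linear R" using R by (rule orthogonal_transformation_linear)
  have norm_R: "norm (R y) = norm y" for y
    using R by (rule orthogonal_transformation_norm)
  then have "R y = 0 \<longleftrightarrow> y = 0" for y
    by (metis norm_eq_zero)
  moreover have "R (y /\<^sub>R norm y) = R y /\<^sub>R norm (R y)" for y
    using \<open>linear R\<close> by (simp only: linear_cmul norm_R)
  moreover have "norm (y /\<^sub>R norm y) = 1" if "y \<noteq> 0" for y :: "real^3"
    using that by simp
  ultimately have "y \<in> ?C (R -` A \<inter> space sphere_measure) \<longleftrightarrow> y \<in> R -` ?C A" for y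
    by (auto simp only: Int_iff vimage_eq Diff_iff singleton_iff space_sphere_measure mem_sphere_0 mem_cball_0 norm_R)
  then have "?C (R -` A \<inter> space sphere_measure) = R -` ?C A"
    by blast
  then show "emeasure (distr sphere_measure sphere_measure R) A = emeasure sphere_measure A"
    using emeasure_sphere_measure[OF A] emeasure_sphere_measure[OF RA]
      emeasure_lborel_orthogonal_vimage[OF R, of "?C A"]
    by (simp add: emeasure_distr[OF measurable_sphere_orthogonal[OF R] A])
qed simp

lemma integral_sphere_orthogonal:
  fixes f :: "real^3 \<Rightarrow> 'b :: {banach, second_countable_topology}"
  assumes R: "orthogonal_transformation R" and f: "f \<in> borel_measurable sphere_measure"
  shows "(LINT x|sphere_measure. f (R x)) = (LINT x|sphere_measure. f x)"
  using integral_distr[OF measurable_sphere_orthogonal[OF R] f] by (simp add: distr_sphere_orthogonal[OF R])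

lemma borel_measurable_sphere_continuous:
  fixes f :: "real^3 \<Rightarrow> 'b :: topological_space"
  assumes "continuous_on UNIV f"
  shows "f \<in> borel_measurable sphere_measure"
proof -
  have "f \<in> borel_measurable (restrict_space borel (sphere 0 1))"
    using assms by (intro measurable_restrict_space1 borel_measurable_continuous_onI)
  then show ?thesis
    by (simp cong: measurable_cong_sets add: sets_sphere_measure)
qed

text \<open>A continuous function is bounded on the compact sphere, whose measure is finite.\<close>

lemma integrable_sphere_continuous:
  fixes f :: "real^3 \<Rightarrow> 'b :: {banach, second_countable_topology}"
  assumes "continuous_on UNIV f"
  shows "integrable sphere_measure f"
proof -
  have "compact (f ` sphere 0 1)"
    using assms by (intro compact_continuous_image) (auto intro: continuous_on_subset)
  then obtain B where B: "\<And>y. y \<in> f ` sphere 0 1 \<Longrightarrow> norm y \<le> B"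
    using compact_imp_bounded bounded_iff by (metis (no_types, lifting))
  have "AE x in sphere_measure. norm (f x) \<le> B"
    by (rule AE_I2) (simp add: B)
  then show ?thesis
    by (rule sphere.integrable_const_bound) (rule borel_measurable_sphere_continuous[OF assms])
qed

section \<open>Orthonormality of the spherical harmonics\<close>

text \<open>Stated with \<open>c\<close> and \<open>s\<close> instead of an angle, so that the
  moment computation can take \<open>1 / r\<close> and \<open>t / r\<close>.\<close>

lemma orthogonal_transformation_rot13:
  assumes "c\<^sup>2 + s\<^sup>2 = 1"
  shows "orthogonal_transformation (\<lambda>x::real^3. vector [c * x $ 1 - s * x $ 3, x $ 2, s * x $ 1 + c * x $ 3] :: real^3)"
proof -
  have "(c * a - s * b) * (c * a' - s * b') + d * d' + (s * a + c * b) * (s * a' + c * b') = a * a' + d * d' + b * b'"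
    for a b a' b' d d'
  proof -
    have "(c * a - s * b) * (c * a' - s * b') + d * d' + (s * a + c * b) * (s * a' + c * b')
        = (c\<^sup>2 + s\<^sup>2) * (a * a' + b * b') + d * d'"
      by (simp add: power2_eq_square algebra_simps)
    then show ?thesis using assms by simp
  qed
  then show ?thesis
    unfolding orthogonal_transformation_def
    by (auto intro!: linearI simp: inner_vec_def sum_3 vec_eq_iff forall_3)
       (simp_all add: algebra_simps)
qed

text \<open>Serves both for the quarter turn \<open>c = 0\<close>, \<open>s = 1\<close> and for a
  general angle about the third axis.\<close>

lemma orthogonal_transformation_rot12:
  assumes "c\<^sup>2 + s\<^sup>2 = 1"
  shows "orthogonal_transformation (\<lambda>x::real^3. vector [c * x $ 1 - s * x $ 2, s * x $ 1 + c * x $ 2, x $ 3] :: real^3)"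
proof -
  have "(c * a - s * b) * (c * a' - s * b') + (s * a + c * b) * (s * a' + c * b') + d * d' = a * a' + b * b' + d * d'"
    for a b a' b' d d'
  proof -
    have "(c * a - s * b) * (c * a' - s * b') + (s * a + c * b) * (s * a' + c * b') + d * d'
        = (c\<^sup>2 + s\<^sup>2) * (a * a' + b * b') + d * d'"
      by (simp add: power2_eq_square algebra_simps)
    then show ?thesis using assms by simp
  qed
  then show ?thesis
    unfolding orthogonal_transformation_def
    by (auto intro!: linearI simp: inner_vec_def sum_3 vec_eq_iff forall_3)
       (simp_all add: algebra_simps)
qed

section \<open>Moments of the third coordinate and Archimedes' theorem\<close>

lemma integral_sphere_even_moment:
  "(LINT x|sphere_measure. (x $ 3) ^ (2 * n)) = 4 * pi / (2 * real n + 1)"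
proof (induction n)
  case 0
  have "measure sphere_measure (sphere 0 1) = 4 * pi"
    by (simp add: measure_def emeasure_sphere_measure_sphere)
  then show ?case by simp
next
  case (Suc n)
  define N where "N = 2 * Suc n"
  define I where "I k = (LINT x|sphere_measure. (x $ 3) ^ k)" for k
  define J where "J j = (LINT x|sphere_measure. (x $ 1) ^ j * (x $ 3) ^ (N - j))" for j
  have int_J: "integrable sphere_measure (\<lambda>x. (x $ 1) ^ j * (x $ 3) ^ (N - j))" for j
    by (intro integrable_sphere_continuous continuous_intros)
  \<comment> \<open>The binomial expansion of the integral of \<open>(x $ 3 + t * x $ 1) ^ N\<close>
    as a polynomial in \<open>t\<close>.\<close>
  define p where "p = (\<Sum>j\<le>N. monom (real (N choose j) * J j) j)"
  have "poly p t = poly (smult (I N) ([:1, 0, 1:] ^ Suc n)) t" for t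
  proof -
    \<comment> \<open>The length of \<open>(1, t)\<close>: dividing by it turns
      \<open>x $ 3 + t * x $ 1\<close> into the third coordinate of a rotated point.\<close>
    define r where "r = sqrt (1 + t\<^sup>2)"
    have r: "r\<^sup>2 = 1 + t\<^sup>2" "r > 0"
      by (simp_all add: r_def add_pos_nonneg)
    have "(1 / r)\<^sup>2 + (t / r)\<^sup>2 = (1 + t\<^sup>2) / r\<^sup>2"
      by (simp add: power_divide add_divide_distrib)
    then have cs: "(1 / r)\<^sup>2 + (t / r)\<^sup>2 = 1"
      using r by (metis divide_self zero_less_power less_irrefl)
    have "I N = (LINT x|sphere_measure. (t / r * x $ 1 + 1 / r * x $ 3) ^ N)"
      unfolding I_def using integral_sphere_orthogonal[OF orthogonal_transformation_rot13[OF cs], of "\<lambda>x. (x $ 3) ^ N"]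
      by (simp add: borel_measurable_sphere_continuous continuous_intros)
    also have "\<dots> = (LINT x|sphere_measure. (1 / r) ^ N * (t * x $ 1 + x $ 3) ^ N)"
      by (simp add: power_mult_distrib[symmetric] algebra_simps)
    also have "\<dots> = (1 / r) ^ N * (LINT x|sphere_measure. (t * x $ 1 + x $ 3) ^ N)"
      by simp
    also have "(LINT x|sphere_measure. (t * x $ 1 + x $ 3) ^ N) =
        (LINT x|sphere_measure. (\<Sum>j\<le>N. real (N choose j) * t ^ j * ((x $ 1) ^ j * (x $ 3) ^ (N - j))))"
      by (simp add: binomial_ring power_mult_distrib mult_ac)
    also have "\<dots> = (\<Sum>j\<le>N. real (N choose j) * t ^ j * J j)"
      using int_J by (subst Bochner_Integration.integral_sum) (auto simp: J_def)
    also have "\<dots> = poly p t"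
      by (simp add: p_def poly_sum poly_monom mult_ac)
    finally have "I N * r ^ N = poly p t"
      using r by (simp add: power_divide field_simps)
    moreover have "r ^ N = (1 + t\<^sup>2) ^ Suc n"
      unfolding N_def power_mult r ..
    moreover have "poly [:1, 0, 1:] t = 1 + t\<^sup>2"
      by (simp add: power2_eq_square)
    ultimately show ?thesis
      by (simp only: poly_smult poly_power)
  qed
  \<comment> \<open>Equality for every real \<open>t\<close> makes the two polynomials equal, so
    their coefficients can be compared.\<close>
  then have "coeff p 2 = coeff (smult (I N) ([:1, 0, 1:] ^ Suc n)) 2"
    by (metis poly_eq_poly_eq_iff ext)
  moreover have "coeff p 2 = real (N choose 2) * J 2"
  proof -
    have "2 \<le> N" by (simp add: N_def)
    then show ?thesis by (simp add: p_def coeff_sum)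
  qed
  \<comment> \<open>The constant term is carried along because the induction for the coefficient of
    \<open>X^2\<close> uses it.\<close>
  moreover have "coeff ([:1, 0, 1:] ^ k) 0 = (1::real) \<and> coeff ([:1, 0, 1:] ^ k) 2 = real k" for k
    by (induction k) (auto simp: coeff_mult numeral_2_eq_2)
  \<comment> \<open>A quarter turn about the third axis exchanges the squares of the first two
    coordinates, and on the sphere these squares add up to \<open>1 - (x $ 3)^2\<close>.\<close>
  moreover have "J 2 = (I (2 * n) - I N) / 2"
  proof -
    have "J 2 = (LINT x|sphere_measure. (x $ 2) ^ 2 * (x $ 3) ^ (N - 2))"
      unfolding J_def using integral_sphere_orthogonal[OF orthogonal_transformation_rot12[of 0 1], of "\<lambda>x. (x $ 2) ^ 2 * (x $ 3) ^ (N - 2)"]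
      by (simp add: borel_measurable_sphere_continuous continuous_intros)
    then have "2 * J 2 = J 2 + (LINT x|sphere_measure. (x $ 2) ^ 2 * (x $ 3) ^ (N - 2))"
      by simp
    also have "\<dots> = (LINT x|sphere_measure. (x $ 1) ^ 2 * (x $ 3) ^ (N - 2) + (x $ 2) ^ 2 * (x $ 3) ^ (N - 2))"
      unfolding J_def by (intro Bochner_Integration.integral_add[symmetric] integrable_sphere_continuous continuous_intros)
    also have "\<dots> = (LINT x|sphere_measure. (x $ 3) ^ (2 * n) - (x $ 3) ^ N)"
    proof (rule Bochner_Integration.integral_cong[OF refl])
      fix x :: "real^3" assume "x \<in> space sphere_measure"
      then have "(x $ 1)\<^sup>2 + (x $ 2)\<^sup>2 = 1 - (x $ 3)\<^sup>2"
        by (simp add: norm_vec_def L2_set_def sum_3 real_sqrt_eq_1_iff)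
      then have "((x $ 1)\<^sup>2 + (x $ 2)\<^sup>2) * (x $ 3) ^ (2 * n) = (1 - (x $ 3)\<^sup>2) * (x $ 3) ^ (2 * n)"
        by simp
      then show "(x $ 1)\<^sup>2 * (x $ 3) ^ (N - 2) + (x $ 2)\<^sup>2 * (x $ 3) ^ (N - 2) = (x $ 3) ^ (2 * n) - (x $ 3) ^ N"
        by (simp add: N_def algebra_simps power2_eq_square)
    qed
    also have "\<dots> = I (2 * n) - I N"
      unfolding I_def by (intro Bochner_Integration.integral_diff integrable_sphere_continuous continuous_intros)
    finally show ?thesis by simp
  qed
  moreover have "real (N choose 2) = real (Suc n) * (2 * real n + 1)"
    by (simp add: N_def choose_two algebra_simps)
  \<comment> \<open>After cancelling \<open>Suc n\<close> this reads
    \<open>(2n + 1) * I (2n) = (2n + 3) * I N\<close>, so the product keeps the value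
    \<open>4 * pi\<close>.\<close>
  ultimately have "real (Suc n) * (2 * real n + 1) * ((I (2 * n) - I N) / 2) = I N * real (Suc n)"
    by (simp only: coeff_smult)
  then have "real (Suc n) * ((2 * real n + 1) * (I (2 * n) - I N)) = real (Suc n) * (2 * I N)"
    by (simp add: field_simps)
  then have "(2 * real n + 1) * I (2 * n) = (2 * real n + 3) * I N"
    by (simp only: mult_cancel_left) (simp add: algebra_simps)
  moreover have "(2 * real n + 1) * I (2 * n) = 4 * pi"
    using Suc.IH by (simp add: I_def field_simps)
  ultimately show ?case
    by (simp add: I_def N_def field_simps)
qed

text \<open>The antipodal map is orthogonal and changes the sign of the integrand.\<close>

lemma integral_sphere_odd_moment:
  assumes "odd k"
  shows "(LINT x|sphere_measure. (x $ 3) ^ k) = 0"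
proof -
  have "(LINT x|sphere_measure. ((- x) $ 3) ^ k) = (LINT x|sphere_measure. (x $ 3) ^ k)"
    by (rule integral_sphere_orthogonal)
      (auto intro!: borel_measurable_sphere_continuous continuous_intros simp: orthogonal_transformation_def linear_uminus)
  then show ?thesis using assms by simp
qed

text \<open>Archimedes' theorem tested on polynomials: by linearity the moments suffice, and the
  parity factor in \<open>symint\<close> is 2 for even and 0 for odd exponents.\<close>

lemma integral_sphere_poly:
  "(LINT x|sphere_measure. poly p (x $ 3)) = 2 * pi * symint p"
proof -
  have *: "(LINT x|sphere_measure. (x $ 3) ^ i) = 2 * pi * ((1 - (-1) ^ Suc i) / real (Suc i))" for i
  proof (cases "even i")
    case True
    then obtain n where "i = 2 * n" by blast
    then show ?thesis by (simp only: integral_sphere_even_moment) (simp add: field_simps)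
  next
    case False
    then show ?thesis by (simp add: integral_sphere_odd_moment)
  qed
  have "(LINT x|sphere_measure. poly p (x $ 3)) = (\<Sum>i\<le>degree p. LINT x|sphere_measure. coeff p i * (x $ 3) ^ i)"
    unfolding poly_altdef by (intro Bochner_Integration.integral_sum integrable_sphere_continuous continuous_intros)
  also have "\<dots> = 2 * pi * symint p"
    by (simp add: * symint_def sum_distrib_left mult_ac)
  finally show ?thesis .
qed

section \<open>Spherical harmonics: phases and orthonormality\<close>

lemma continuous_on_sph_harm_nonneg [continuous_intros]: "continuous_on A (sph_harm_nonneg l m)"
  unfolding sph_harm_nonneg_def[abs_def] Complex_eq by (intro continuous_intros)

lemma continuous_on_sph_harm [continuous_intros]: "continuous_on A (sph_harm l m)"
  unfolding sph_harm_def[abs_def]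
  by (cases "l < nat \<bar>m\<bar>"; cases "0 \<le> m"; simp add: continuous_intros)

text \<open>Rotation about the third axis fixes \<open>x $ 3\<close> and multiplies
  \<open>x $ 1 + i * x $ 2\<close> by \<open>cis t\<close>; conjugation gives the opposite phase for
  negative orders.\<close>

lemma sph_harm_rot12:
  "sph_harm l m (vector [cos t * x $ 1 - sin t * x $ 2, sin t * x $ 1 + cos t * x $ 2, x $ 3]) =
    cis (of_int m * t) * sph_harm l m x"
proof -
  have "Complex (cos t * a - sin t * b) (sin t * a + cos t * b) = cis t * Complex a b" for a b
    by (simp add: complex_eq_iff)
  then have power: "Complex (cos t * a - sin t * b) (sin t * a + cos t * b) ^ n = cis (real n * t) * Complex a b ^ n" for a b n
    by (simp only: power_mult_distrib Complex.DeMoivre)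
  have *: "sph_harm_nonneg l n (vector [cos t * x $ 1 - sin t * x $ 2, sin t * x $ 1 + cos t * x $ 2, x $ 3]) =
    cis (real n * t) * sph_harm_nonneg l n x" for n
    unfolding sph_harm_nonneg_def vector_3 power by (simp only: mult_ac)
  show ?thesis
    by (simp add: sph_harm_def * cis_cnj)
qed

lemma sph_harm_orthogonal_order:
  assumes "m \<noteq> j"
  shows "(LINT x|sphere_measure. sph_harm l m x * cnj (sph_harm k j x)) = 0"
proof -
  \<comment> \<open>With this angle the product of the two phases is \<open>-1\<close>, so the
    integral equals its own negative.\<close>
  define t where "t = pi / of_int (m - j)"
  let ?I = "LINT x|sphere_measure. sph_harm l m x * cnj (sph_harm k j x)"
  have "of_int (m - j) * t = pi"
    using assms by (simp add: t_def)
  then have "of_int m * t - of_int j * t = pi"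
    by (simp add: left_diff_distrib)
  then have "cis (of_int m * t) * cnj (cis (of_int j * t)) = - 1"
    by (simp add: cis_cnj cis_mult flip: cis_pi)
  note cis = this
  have "?I = (LINT x|sphere_measure. (cis (of_int m * t) * cnj (cis (of_int j * t))) * (sph_harm l m x * cnj (sph_harm k j x)))"
    using integral_sphere_orthogonal[OF orthogonal_transformation_rot12[of "cos t" "sin t"],
        of "\<lambda>x. sph_harm l m x * cnj (sph_harm k j x)"]
    by (simp add: borel_measurable_sphere_continuous continuous_intros sph_harm_rot12 mult_ac)
  also have "\<dots> = - ?I"
    unfolding cis by simp
  finally show ?thesis by simp
qed

text \<open>On the sphere \<open>|x $ 1 + i * x $ 2|^2 = 1 - (x $ 3)^2\<close>, so for equal orders
  the product is a real polynomial in \<open>x $ 3\<close>. The normalizing factors invert the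
  associated Legendre norm together with \<open>2 * pi\<close>.\<close>

lemma sph_harm_nonneg_orthonormal:
  assumes "m \<le> l" "m \<le> k"
  shows "(LINT x|sphere_measure. sph_harm_nonneg l m x * cnj (sph_harm_nonneg k m x)) = (if l = k then 1 else 0)"
proof -
  define N where "N l = sqrt ((2 * real l + 1) / (4 * pi) * (fact (l - m) / fact (l + m)))" for l
  define P where "P l = (pderiv ^^ m) (legendre_poly l)" for l
  have "(LINT x|sphere_measure. sph_harm_nonneg l m x * cnj (sph_harm_nonneg k m x)) =
      (LINT x|sphere_measure. complex_of_real (N l * N k * poly ([:1, 0, -1:] ^ m * P l * P k) (x $ 3)))"
  proof (rule Bochner_Integration.integral_cong[OF refl])
    fix x :: "real^3" assume "x \<in> space sphere_measure"
    then have "(x $ 1)\<^sup>2 + (x $ 2)\<^sup>2 = 1 - x $ 3 * x $ 3"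
      by (simp add: norm_vec_def L2_set_def sum_3 real_sqrt_eq_1_iff power2_eq_square)
    then have "Complex (x $ 1) (x $ 2) * cnj (Complex (x $ 1) (x $ 2)) = complex_of_real (1 - x $ 3 * x $ 3)"
      by (simp only: complex_mult_cnj complex.sel)
    then have z: "Complex (x $ 1) (x $ 2) ^ m * cnj (Complex (x $ 1) (x $ 2)) ^ m = complex_of_real ((1 - x $ 3 * x $ 3) ^ m)"
      by (simp only: power_mult_distrib[symmetric] of_real_power)
    have "sph_harm_nonneg l m x * cnj (sph_harm_nonneg k m x) =
        complex_of_real (N l * (-1) ^ m * poly (P l) (x $ 3) * (N k * (-1) ^ m * poly (P k) (x $ 3)))
          * (Complex (x $ 1) (x $ 2) ^ m * cnj (Complex (x $ 1) (x $ 2)) ^ m)"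
      unfolding sph_harm_nonneg_def N_def[symmetric] P_def[symmetric]
      by (simp only: complex_cnj_mult complex_cnj_power complex_cnj_complex_of_real of_real_mult mult_ac)
    also have "\<dots> = complex_of_real (((-1) ^ m * (-1) ^ m) * (N l * N k * ((1 - x $ 3 * x $ 3) ^ m * poly (P l) (x $ 3) * poly (P k) (x $ 3))))"
      unfolding z by (simp only: of_real_mult mult_ac)
    also have "(-1) ^ m * (-1) ^ m = (1::real)"
      by (simp flip: power_mult_distrib)
    finally show "sph_harm_nonneg l m x * cnj (sph_harm_nonneg k m x) =
      complex_of_real (N l * N k * poly ([:1, 0, -1:] ^ m * P l * P k) (x $ 3))"
      by simp
  qed
  also have "\<dots> = complex_of_real (LINT x|sphere_measure. N l * N k * poly ([:1, 0, -1:] ^ m * P l * P k) (x $ 3))"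
    by (rule integral_complex_of_real)
  also have "(LINT x|sphere_measure. N l * N k * poly ([:1, 0, -1:] ^ m * P l * P k) (x $ 3)) =
      N l * N k * (2 * pi * symint ([:1, 0, -1:] ^ m * P l * P k))"
    by (simp only: integral_mult_right_zero integral_sphere_poly)
  also have "\<dots> = (if l = k then 1 else 0)"
  proof (cases "l = k")
    case True
    have "N l * N l = (2 * real l + 1) / (4 * pi) * (fact (l - m) / fact (l + m))"
      by (simp add: N_def)
    moreover have "symint ([:1, 0, -1:] ^ m * P l * P k) = 2 / (2 * real l + 1) * (fact (l + m) / fact (l - m))"
      using assms True by (simp add: P_def symint_assoc_legendre)
    ultimately show ?thesis
      using True by simp
  next
    case False
    then show ?thesis
      using assms by (simp add: P_def symint_assoc_legendre)
  qed
  finally show ?thesis by simp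
qed

lemma sph_harm_orthonormal:
  assumes "\<bar>m\<bar> \<le> int l" "\<bar>j\<bar> \<le> int k"
  shows "(LINT x|sphere_measure. sph_harm l m x * cnj (sph_harm k j x)) = (if l = k \<and> m = j then 1 else 0)"
proof (cases "m = j")
  case True
  have le: "nat \<bar>m\<bar> \<le> l" "nat \<bar>m\<bar> \<le> k"
    using assms True by auto
  show ?thesis
  proof (cases "m \<ge> 0")
    case m: True
    then show ?thesis
      using le True by (simp add: sph_harm_def sph_harm_nonneg_orthonormal)
  next
    case False
    \<comment> \<open>For negative orders conjugation exchanges the two factors, and the signs occur
      twice and cancel.\<close>
    have "(LINT x|sphere_measure. sph_harm l m x * cnj (sph_harm k j x)) =
        (LINT x|sphere_measure. (- 1) ^ nat (- m) * (- 1) ^ nat (- m) * (sph_harm_nonneg k (nat (- m)) x * cnj (sph_harm_nonneg l (nat (- m)) x)))"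
      using le False True by (simp add: sph_harm_def mult_ac)
    also have "\<dots> = (if l = k \<and> m = j then 1 else 0)"
      using le False True by (simp add: sph_harm_nonneg_orthonormal flip: power_mult_distrib)
    finally show ?thesis .
  qed
qed (simp add: sph_harm_orthogonal_order)

section \<open>Parseval's identity for finite expansions\<close>

lemma continuous_on_harm_partial_sum [continuous_intros]: "continuous_on A (harm_partial_sum b L)"
  unfolding harm_partial_sum_def[abs_def] by (intro continuous_intros)

text \<open>The double sum is flattened to the index set \<open>K\<close> of pairs of degree and
  order, where orthonormality leaves only the diagonal. The computation runs over the complex
  numbers, where the squared modulus is a product with the conjugate.\<close>

lemma nn_integral_harm_partial_sum:
  "(\<integral>\<^sup>+ x. ennreal ((cmod (harm_partial_sum b L x))\<^sup>2) \<partial>sphere_measure) = (\<Sum>l\<le>L. ennreal ((band_norm b l)\<^sup>2))"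
proof -
  define K where "K = Sigma {..L} (\<lambda>l. {- int l..int l})"
  define Y where "Y p = sph_harm (fst p) (snd p)" for p
  define B where "B p = b (fst p) (snd p)" for p
  have fin [simp]: "finite K" by (simp add: K_def)
  have S: "harm_partial_sum b L x = (\<Sum>p\<in>K. B p * Y p x)" for x
    by (simp add: harm_partial_sum_def K_def sum.Sigma B_def Y_def split_def)
  have orth: "(LINT x|sphere_measure. Y p x * cnj (Y q x)) = (if p = q then 1 else 0)" if "p \<in> K" "q \<in> K" for p q
    using that unfolding Y_def K_def by (subst sph_harm_orthonormal) (auto simp: prod_eq_iff)
  have contY: "continuous_on UNIV (Y p)" for p
    unfolding Y_def by (rule continuous_on_sph_harm)
  have "complex_of_real (LINT x|sphere_measure. (cmod (harm_partial_sum b L x))\<^sup>2) =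
      (LINT x|sphere_measure. complex_of_real ((cmod (harm_partial_sum b L x))\<^sup>2))"
    by (rule integral_complex_of_real[symmetric])
  also have "\<dots> = (LINT x|sphere_measure. (\<Sum>p\<in>K. \<Sum>q\<in>K. B p * cnj (B q) * (Y p x * cnj (Y q x))))"
    unfolding complex_norm_square S by (simp add: sum_product mult_ac)
  also have "\<dots> = (\<Sum>p\<in>K. \<Sum>q\<in>K. LINT x|sphere_measure. B p * cnj (B q) * (Y p x * cnj (Y q x)))"
    by (subst Bochner_Integration.integral_sum; (subst Bochner_Integration.integral_sum)?)
       (auto intro!: integrable_sphere_continuous continuous_intros contY)
  also have "\<dots> = (\<Sum>p\<in>K. \<Sum>q\<in>K. if p = q then B p * cnj (B q) else 0)"
    by (intro sum.cong refl) (simp add: orth)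
  also have "\<dots> = complex_of_real (\<Sum>p\<in>K. (cmod (B p))\<^sup>2)"
    by (simp add: complex_norm_square del: of_real_power)
  finally have "(LINT x|sphere_measure. (cmod (harm_partial_sum b L x))\<^sup>2) = (\<Sum>p\<in>K. (cmod (B p))\<^sup>2)"
    by (simp only: of_real_eq_iff)
  also have "\<dots> = (\<Sum>l\<le>L. (band_norm b l)\<^sup>2)"
    by (simp add: band_norm_def sum_nonneg K_def B_def sum.Sigma split_def)
  finally have "ennreal (LINT x|sphere_measure. (cmod (harm_partial_sum b L x))\<^sup>2) = (\<Sum>l\<le>L. ennreal ((band_norm b l)\<^sup>2))"
    by (simp add: sum_ennreal)
  then show ?thesis
    by (subst nn_integral_eq_integral) (auto intro!: integrable_sphere_continuous continuous_intros)
qed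

section \<open>Mean square error of the regularized field\<close>

context
  fixes M :: "'w measure"
  assumes M: "prob_space M"
begin

interpretation prob_space M by (rule M)

section \<open>Random fields on the product space and the tails of their spectra\<close>

lemma measurable_harm_partial_sum:
  assumes "\<And>l m. (\<lambda>\<omega>. b \<omega> l m) \<in> borel_measurable M"
  shows "(\<lambda>z. harm_partial_sum (b (fst z)) L (snd z)) \<in> borel_measurable (M \<Otimes>\<^sub>M sphere_measure)"
proof -
  have [measurable]: "sph_harm l m \<in> borel_measurable sphere_measure" for l m
    by (intro borel_measurable_sphere_continuous continuous_intros)
  note assms [measurable]
  show ?thesis unfolding harm_partial_sum_def by measurable
qed

text \<open>Tonelli, followed by Parseval for each realization.\<close>

lemma L2sq_harm_partial_sum:
  assumes "\<And>l m. (\<lambda>\<omega>. b \<omega> l m) \<in> borel_measurable M"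
  shows "L2sq M (\<lambda>\<omega>. harm_partial_sum (b \<omega>) L) = (\<Sum>l\<le>L. \<integral>\<^sup>+ \<omega>. ennreal ((band_norm (b \<omega>) l)\<^sup>2) \<partial>M)"
proof -
  note assms [measurable] measurable_harm_partial_sum[OF assms, measurable]
  have "L2sq M (\<lambda>\<omega>. harm_partial_sum (b \<omega>) L) =
      (\<integral>\<^sup>+ \<omega>. \<integral>\<^sup>+ x. ennreal ((cmod (harm_partial_sum (b \<omega>) L x))\<^sup>2) \<partial>sphere_measure \<partial>M)"
    unfolding L2sq_def by (subst sphere.nn_integral_fst[symmetric]) simp_all
  also have "\<dots> = (\<Sum>l\<le>L. \<integral>\<^sup>+ \<omega>. ennreal ((band_norm (b \<omega>) l)\<^sup>2) \<partial>M)"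
    unfolding nn_integral_harm_partial_sum
    by (subst nn_integral_sum) (simp_all add: band_norm_def)
  finally show ?thesis .
qed

text \<open>Working in \<open>ennreal\<close> spares every finiteness condition.\<close>

lemma L2sq_add_le:
  assumes [measurable]: "(\<lambda>z. f (fst z) (snd z)) \<in> borel_measurable (M \<Otimes>\<^sub>M sphere_measure)"
    "(\<lambda>z. g (fst z) (snd z)) \<in> borel_measurable (M \<Otimes>\<^sub>M sphere_measure)"
  shows "L2sq M (\<lambda>\<omega> x. f \<omega> x + g \<omega> x) \<le> 2 * L2sq M f + 2 * L2sq M g"
proof -
  have "(cmod (a + b))\<^sup>2 \<le> 2 * (cmod a)\<^sup>2 + 2 * (cmod b)\<^sup>2" for a b
  proof -
    have "(cmod (a + b))\<^sup>2 \<le> (cmod a + cmod b)\<^sup>2"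
      by (intro power_mono norm_triangle_ineq) simp
    also have "\<dots> \<le> 2 * (cmod a)\<^sup>2 + 2 * (cmod b)\<^sup>2"
      using zero_le_power2[of "cmod a - cmod b"] by (simp add: power2_eq_square algebra_simps)
    finally show ?thesis .
  qed
  then have "ennreal ((cmod (a + b))\<^sup>2) \<le> 2 * ennreal ((cmod a)\<^sup>2) + 2 * ennreal ((cmod b)\<^sup>2)" for a b
    using ennreal_leI[of "(cmod (a + b))\<^sup>2" "2 * (cmod a)\<^sup>2 + 2 * (cmod b)\<^sup>2"] by (simp add: ennreal_mult')
  then have "L2sq M (\<lambda>\<omega> x. f \<omega> x + g \<omega> x) \<le>
      (\<integral>\<^sup>+ z. 2 * ennreal ((cmod (f (fst z) (snd z)))\<^sup>2) + 2 * ennreal ((cmod (g (fst z) (snd z)))\<^sup>2) \<partial>(M \<Otimes>\<^sub>M sphere_measure))"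
    unfolding L2sq_def by (intro nn_integral_mono)
  also have "\<dots> = 2 * L2sq M f + 2 * L2sq M g"
    unfolding L2sq_def by (simp add: nn_integral_add nn_integral_cmult)
  finally show ?thesis .
qed

lemma L2sq_minus_commute: "L2sq M (\<lambda>\<omega> x. f \<omega> x - g \<omega> x) = L2sq M (\<lambda>\<omega> x. g \<omega> x - f \<omega> x)"
  unfolding L2sq_def by (simp add: norm_minus_commute)

lemma measurable_field_coeff:
  assumes [measurable]: "(\<lambda>z. T (fst z) (snd z)) \<in> borel_measurable (M \<Otimes>\<^sub>M sphere_measure)"
  shows "(\<lambda>\<omega>. field_coeff T \<omega> l m) \<in> borel_measurable M"
proof -
  have [measurable]: "sph_harm l m \<in> borel_measurable sphere_measure" for l m
    by (intro borel_measurable_sphere_continuous continuous_intros)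
  have [measurable]: "cnj \<in> borel_measurable borel"
    by (intro borel_measurable_continuous_onI continuous_intros)
  have "(\<lambda>(\<omega>, x). complex_of_real (T \<omega> x) * cnj (sph_harm l m x)) \<in> borel_measurable (M \<Otimes>\<^sub>M sphere_measure)"
    unfolding split_beta' by measurable
  then show ?thesis
    unfolding field_coeff_def by (rule sphere.borel_measurable_lebesgue_integral)
qed

text \<open>The partial sums of the spectrum are bounded by the energy of \<open>T\<close> plus a
  vanishing remainder, up to factors 2, so the series is finite and its tails tend to 0. This is
  what makes the minimum defining \<open>lstar\<close> exist.\<close>

lemma band_tail_tendsto_0:
  assumes T: "(\<lambda>z. T (fst z) (snd z)) \<in> borel_measurable (M \<Otimes>\<^sub>M sphere_measure)"
    and fin: "L2sq M (\<lambda>\<omega> x. complex_of_real (T \<omega> x)) < \<infinity>"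
    and lim: "(\<lambda>L. L2sq M (\<lambda>\<omega> x. complex_of_real (T \<omega> x) - harm_partial_sum (field_coeff T \<omega>) L x)) \<longlonglongrightarrow> 0"
  shows "band_tail M T \<longlonglongrightarrow> 0"
proof -
  define e where "e l = (\<integral>\<^sup>+ \<omega>. ennreal ((band_norm (field_coeff T \<omega>) l)\<^sup>2) \<partial>M)" for l
  note T [measurable]
  note [measurable] = measurable_harm_partial_sum[of "field_coeff T", OF measurable_field_coeff[OF T]]
  let ?R = "\<lambda>L. L2sq M (\<lambda>\<omega> x. harm_partial_sum (field_coeff T \<omega>) L x - complex_of_real (T \<omega> x))"
  have le: "(\<Sum>l\<le>L. e l) \<le> 2 * L2sq M (\<lambda>\<omega> x. complex_of_real (T \<omega> x)) + 2 * ?R L" for L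
  proof -
    have "(\<Sum>l\<le>L. e l) = L2sq M (\<lambda>\<omega> x. complex_of_real (T \<omega> x) + (harm_partial_sum (field_coeff T \<omega>) L x - complex_of_real (T \<omega> x)))"
      using L2sq_harm_partial_sum[of "field_coeff T", OF measurable_field_coeff[OF T]] by (simp add: e_def)
    also have "\<dots> \<le> 2 * L2sq M (\<lambda>\<omega> x. complex_of_real (T \<omega> x)) + 2 * ?R L"
      by (rule L2sq_add_le) simp_all
    finally show ?thesis .
  qed
  have "?R \<longlonglongrightarrow> 0"
    using lim by (subst L2sq_minus_commute)
  then have "(\<lambda>L. 2 * L2sq M (\<lambda>\<omega> x. complex_of_real (T \<omega> x)) + 2 * ?R L) \<longlonglongrightarrow> 2 * L2sq M (\<lambda>\<omega> x. complex_of_real (T \<omega> x)) + 2 * 0"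
    by (intro tendsto_add tendsto_const ennreal_tendsto_cmult) simp_all
  moreover have "(\<lambda>L. \<Sum>l\<le>L. e l) \<longlonglongrightarrow> (\<Sum>l. e l)"
    using summable_LIMSEQ'[of e] by simp
  ultimately have "(\<Sum>l. e l) \<le> 2 * L2sq M (\<lambda>\<omega> x. complex_of_real (T \<omega> x)) + 2 * 0"
    by (intro LIMSEQ_le) (use le in auto)
  then have "(\<Sum>l. e l) < \<infinity>"
    using fin by (metis add.right_neutral ennreal_mult_less_top infinity_ennreal_def le_less_trans mult_zero_right ennreal_numeral_less_top)
  \<comment> \<open>The total splits into head and tail; the head is finite and can therefore be
    cancelled in \<open>ennreal\<close>.\<close>
  have "band_tail M T k = (\<Sum>l. e l) - (\<Sum>l\<le>k. e l)" for k
  proof -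
    have "(\<Sum>l. e l) = (\<Sum>l. (if k < l then e l else 0) + (if l \<in> {..k} then e l else 0))"
      by (intro suminf_cong) auto
    also have "\<dots> = band_tail M T k + (\<Sum>l. if l \<in> {..k} then e l else 0)"
      unfolding band_tail_def e_def by (intro suminf_add[symmetric]) auto
    also have "(\<Sum>l. if l \<in> {..k} then e l else 0) = (\<Sum>l\<le>k. e l)"
      by (subst suminf_finite[of "{..k}"]) auto
    finally have "(\<Sum>l. e l) = band_tail M T k + (\<Sum>l\<le>k. e l)" .
    moreover have "(\<Sum>l\<le>k. e l) \<le> (\<Sum>l. e l)"
      by (intro sum_le_suminf) auto
    then have "(\<Sum>l\<le>k. e l) \<noteq> \<top>"
      using \<open>(\<Sum>l. e l) < \<infinity>\<close> by (metis infinity_ennreal_def leD)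
    ultimately show ?thesis
      by (metis ennreal_add_diff_cancel_right)
  qed
  then have "band_tail M T = (\<lambda>k. (\<Sum>l. e l) - (\<Sum>l\<le>k. e l))"
    by (rule ext)
  moreover have "(\<lambda>k. (\<Sum>l. e l) - (\<Sum>l\<le>k. e l)) \<longlonglongrightarrow> (\<Sum>l. e l) - (\<Sum>l. e l)"
    using \<open>(\<Sum>l. e l) < \<infinity>\<close> \<open>(\<lambda>L. \<Sum>l\<le>L. e l) \<longlonglongrightarrow> (\<Sum>l. e l)\<close>
    by (intro tendsto_diff_ennreal tendsto_const) auto
  moreover have "(\<Sum>l. e l) - (\<Sum>l. e l) = 0"
    using \<open>(\<Sum>l. e l) < \<infinity>\<close> by simp
  ultimately show ?thesis
    by (simp only:)
qed

end

section \<open>Soft thresholding of a single band\<close>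

lemma band_norm_nonneg: "0 \<le> band_norm a l"
  by (simp add: band_norm_def sum_nonneg)

lemma band_norm_scale: "band_norm (\<lambda>l m. c l * a l m) l = cmod (c l) * band_norm a l"
  by (simp add: band_norm_def norm_mult power_mult_distrib real_sqrt_mult flip: sum_distrib_left)

lemma band_norm_diff_reg_coeff:
  assumes "0 \<le> lam" "0 < beta l"
  shows "band_norm (\<lambda>l m. a l m - reg_coeff lam beta a l m) l = min (lam * beta l) (band_norm a l)"
proof -
  \<comment> \<open>The fraction of the band that thresholding removes: all of it at or below the
    threshold.\<close>
  define c where "c l = (if band_norm a l > lam * beta l then complex_of_real (lam * beta l / band_norm a l) else 1)" for l
  have "(\<lambda>l m. a l m - reg_coeff lam beta a l m) = (\<lambda>l m. c l * a l m)"
    by (auto simp: fun_eq_iff reg_coeff_def c_def algebra_simps)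
  moreover have "cmod (c l) * band_norm a l = min (lam * beta l) (band_norm a l)"
  proof (cases "band_norm a l > lam * beta l")
    case True
    \<comment> \<open>A nonnegative threshold forces a positive band norm in this branch, so the
      quotient in \<open>c\<close> cancels.\<close>
    moreover have "0 \<le> lam * beta l"
      using assms by simp
    moreover from calculation have "0 < band_norm a l"
      by linarith
    ultimately show ?thesis
      by (simp add: c_def norm_divide flip: of_real_mult)
  qed (simp add: c_def)
  ultimately show ?thesis by (simp add: band_norm_scale)
qed

theorem theorem5p2:
  fixes M :: "'w measure"
    and To :: "'w \<Rightarrow> real^3 \<Rightarrow> real"
    and Tr :: "'w \<Rightarrow> real^3 \<Rightarrow> complex"
    and \<epsilon> lam :: real and beta :: "nat \<Rightarrow> real" and lstar :: nat
  assumes "prob_space M"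
    and "(\<lambda>z. To (fst z) (snd z)) \<in> borel_measurable (M \<Otimes>\<^sub>M sphere_measure)"
    and "L2sq M (\<lambda>\<omega> x. complex_of_real (To \<omega> x)) < \<infinity>"
    and "(\<lambda>L. L2sq M (\<lambda>\<omega> x. complex_of_real (To \<omega> x)
                 - harm_partial_sum (field_coeff To \<omega>) L x)) \<longlonglongrightarrow> 0"
    and "\<epsilon> > 0"
    and "\<forall>l. beta l > 0"
    and "lstar = (LEAST k. band_tail M To k \<le> ennreal (\<epsilon>\<^sup>2 / 4))"
    and "0 \<le> lam"
    and "lam < \<epsilon> / (2 * sqrt (\<Sum>l\<le>lstar. (beta l)\<^sup>2))"
    and "(\<lambda>z. Tr (fst z) (snd z)) \<in> borel_measurable (M \<Otimes>\<^sub>M sphere_measure)"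
    and "(\<lambda>L. L2sq M (\<lambda>\<omega> x. Tr \<omega> x
                 - harm_partial_sum (reg_coeff lam beta (field_coeff To \<omega>)) L x)) \<longlonglongrightarrow> 0"
  shows "L2norm M (\<lambda>\<omega> x. complex_of_real (To \<omega> x) - Tr \<omega> x) < ennreal \<epsilon>"
proof -
  interpret prob_space M by fact
  note M = assms(1) and To [measurable] = assms(2) and Tr [measurable] = assms(10)
  define a where "a = field_coeff To"
  define b where "b \<omega> = reg_coeff lam beta (a \<omega>)" for \<omega>
  define d where "d \<omega> l m = a \<omega> l m - b \<omega> l m" for \<omega> l m
  define D where "D = L2sq M (\<lambda>\<omega> x. complex_of_real (To \<omega> x) - Tr \<omega> x)"
  \<comment> \<open>Mean-square bound for all partial sums of the error: the thresholds up to
    \<open>lstar\<close>, then the tail beyond.\<close>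
  define C where "C = lam\<^sup>2 * (\<Sum>l\<le>lstar. (beta l)\<^sup>2) + \<epsilon>\<^sup>2 / 4"
  have a [measurable]: "(\<lambda>\<omega>. a \<omega> l m) \<in> borel_measurable M" for l m
    unfolding a_def by (rule measurable_field_coeff[OF M To])
  have [measurable]: "(\<lambda>\<omega>. band_norm (a \<omega>) l) \<in> borel_measurable M" for l
    unfolding band_norm_def by measurable
  have b [measurable]: "(\<lambda>\<omega>. b \<omega> l m) \<in> borel_measurable M" for l m
    unfolding b_def reg_coeff_def by measurable
  have d [measurable]: "(\<lambda>\<omega>. d \<omega> l m) \<in> borel_measurable M" for l m
    unfolding d_def by measurable
  note [measurable] = measurable_harm_partial_sum[OF M a] measurable_harm_partial_sum[OF M b]
    measurable_harm_partial_sum[OF M d]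
  have S_diff: "harm_partial_sum (d \<omega>) L x = harm_partial_sum (a \<omega>) L x - harm_partial_sum (b \<omega>) L x" for \<omega> L x
    by (simp add: harm_partial_sum_def d_def left_diff_distrib sum_subtractf)

  \<comment> \<open>Without a witness the \<open>LEAST\<close> in the definition of
    \<open>lstar\<close> would carry no information.\<close>
  have "\<exists>k. band_tail M To k \<le> ennreal (\<epsilon>\<^sup>2 / 4)"
  proof -
    have "eventually (\<lambda>k. band_tail M To k < ennreal (\<epsilon>\<^sup>2 / 4)) sequentially"
      using band_tail_tendsto_0[OF assms(1-4)] \<open>\<epsilon> > 0\<close>
      by (intro order_tendstoD(2)[where y = 0]) (simp_all only: ennreal_less_zero_iff zero_less_divide_iff zero_less_power zero_less_numeral simp_thms)
    then show ?thesis
      by (meson eventually_sequentially order.refl order.strict_implies_order)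
  qed
  then have tail: "band_tail M To lstar \<le> ennreal (\<epsilon>\<^sup>2 / 4)"
    unfolding assms(7) by (rule LeastI_ex)

  have bound: "L2sq M (\<lambda>\<omega>. harm_partial_sum (d \<omega>) L) \<le> ennreal C" for L
  proof -
    define e where "e l = (\<integral>\<^sup>+ \<omega>. ennreal ((band_norm (d \<omega>) l)\<^sup>2) \<partial>M)" for l
    define g where "g l = (if lstar < l then (\<integral>\<^sup>+ \<omega>. ennreal ((band_norm (a \<omega>) l)\<^sup>2) \<partial>M) else 0)" for l
    have d_min: "band_norm (d \<omega>) l = min (lam * beta l) (band_norm (a \<omega>) l)" for \<omega> l
      using assms(6,8) unfolding d_def[abs_def] b_def by (intro band_norm_diff_reg_coeff) auto
    \<comment> \<open>For each \<open>l\<close> one of the two summands is 0: the threshold bounds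
      low degrees and the original energy bounds high ones.\<close>
    have "e l \<le> ennreal (if l \<le> lstar then (lam * beta l)\<^sup>2 else 0) + g l" for l
    proof (cases "l \<le> lstar")
      case True
      \<comment> \<open>The deterministic bound integrates to itself because the total mass is
        1.\<close>
      have "e l \<le> (\<integral>\<^sup>+ \<omega>. ennreal ((lam * beta l)\<^sup>2) \<partial>M)"
        unfolding e_def using assms(6,8)
        by (intro nn_integral_mono ennreal_leI power_mono) (auto simp: d_min band_norm_nonneg less_imp_le)
      then show ?thesis using True by (simp add: g_def emeasure_space_1)
    next
      case False
      have "e l \<le> (\<integral>\<^sup>+ \<omega>. ennreal ((band_norm (a \<omega>) l)\<^sup>2) \<partial>M)"
        unfolding e_def using assms(6,8)
        by (intro nn_integral_mono ennreal_leI power_mono) (auto simp: d_min band_norm_nonneg less_imp_le)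
      then show ?thesis using False by (simp add: g_def)
    qed
    then have "(\<Sum>l\<le>L. e l) \<le> (\<Sum>l\<le>L. ennreal (if l \<le> lstar then (lam * beta l)\<^sup>2 else 0) + g l)"
      by (intro sum_mono)
    also have "\<dots> = ennreal (\<Sum>l\<le>L. if l \<le> lstar then (lam * beta l)\<^sup>2 else 0) + (\<Sum>l\<le>L. g l)"
      by (simp add: sum.distrib sum_ennreal)
    also have "\<dots> \<le> ennreal (lam\<^sup>2 * (\<Sum>l\<le>lstar. (beta l)\<^sup>2)) + ennreal (\<epsilon>\<^sup>2 / 4)"
    proof (intro add_mono ennreal_leI)
      \<comment> \<open>\<open>L\<close> may lie on either side of \<open>lstar\<close>, hence the
        intersection before enlarging to the full range.\<close>
      have "(\<Sum>l\<le>L. if l \<le> lstar then (lam * beta l)\<^sup>2 else 0) = (\<Sum>l\<in>{..L} \<inter> {..lstar}. (lam * beta l)\<^sup>2)"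
        by (subst sum.inter_restrict) (auto intro: sum.cong)
      also have "\<dots> \<le> (\<Sum>l\<le>lstar. (lam * beta l)\<^sup>2)"
        by (intro sum_mono2) auto
      finally show "(\<Sum>l\<le>L. if l \<le> lstar then (lam * beta l)\<^sup>2 else 0) \<le> lam\<^sup>2 * (\<Sum>l\<le>lstar. (beta l)\<^sup>2)"
        by (simp add: sum_distrib_left power_mult_distrib)
      have "(\<Sum>l\<le>L. g l) \<le> (\<Sum>l. g l)"
        by (intro sum_le_suminf) auto
      also have "\<dots> = band_tail M To lstar"
        unfolding band_tail_def g_def a_def ..
      finally show "(\<Sum>l\<le>L. g l) \<le> ennreal (\<epsilon>\<^sup>2 / 4)"
        using tail by (rule order.trans)
    qed
    also have "\<dots> = ennreal C"
      by (simp add: C_def sum_nonneg)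
    finally show ?thesis
      using L2sq_harm_partial_sum[OF M d] by (simp add: e_def)
  qed

  \<comment> \<open>The condition on \<open>lam\<close> makes the first term of \<open>C\<close>
    less than \<open>\<epsilon>\<^sup>2 / 4\<close>. The bound is independent of \<open>L\<close>,
    so strictness survives the limit.\<close>
  have "2 * C < \<epsilon>\<^sup>2"
  proof -
    define s where "s = (\<Sum>l\<le>lstar. (beta l)\<^sup>2)"
    have "s > 0"
      unfolding s_def using assms(6) by (intro sum_pos) (auto simp: less_imp_neq[symmetric])
    then have "lam * sqrt s < \<epsilon> / 2"
      using assms(9) by (simp add: s_def[symmetric] field_simps)
    then have "(lam * sqrt s)\<^sup>2 < (\<epsilon> / 2)\<^sup>2"
      using assms(8) \<open>s > 0\<close> by (intro power_strict_mono) auto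
    then show ?thesis
      using \<open>s > 0\<close> by (simp add: C_def s_def[symmetric] power_mult_distrib power_divide)
  qed

  let ?ro = "\<lambda>L. L2sq M (\<lambda>\<omega> x. complex_of_real (To \<omega> x) - harm_partial_sum (a \<omega>) L x)"
  let ?rr = "\<lambda>L. L2sq M (\<lambda>\<omega> x. Tr \<omega> x - harm_partial_sum (b \<omega>) L x)"
  \<comment> \<open>The error is the partial sum with coefficients \<open>d\<close> plus the two
    expansion remainders. The inequality for sums is applied twice, and only the outer factor 2
    reaches \<open>C\<close>.\<close>
  have D_le: "D \<le> 2 * ennreal C + 2 * (2 * ?ro L + 2 * ?rr L)" for L
  proof -
    let ?f = "\<lambda>\<omega> x. complex_of_real (To \<omega> x) - harm_partial_sum (a \<omega>) L x"
    let ?g = "\<lambda>\<omega> x. harm_partial_sum (b \<omega>) L x - Tr \<omega> x"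
    have "D = L2sq M (\<lambda>\<omega> x. harm_partial_sum (d \<omega>) L x + (?f \<omega> x + ?g \<omega> x))"
      by (simp add: D_def S_diff)
    also have "\<dots> \<le> 2 * L2sq M (\<lambda>\<omega>. harm_partial_sum (d \<omega>) L) + 2 * L2sq M (\<lambda>\<omega> x. ?f \<omega> x + ?g \<omega> x)"
      by (rule L2sq_add_le[OF M]) simp_all
    also have "\<dots> \<le> 2 * ennreal C + 2 * (2 * L2sq M ?f + 2 * L2sq M ?g)"
      by (intro add_mono mult_left_mono bound L2sq_add_le[OF M]) simp_all
    also have "L2sq M ?g = ?rr L"
      by (rule L2sq_minus_commute[OF M])
    finally show ?thesis .
  qed
  have "(\<lambda>L. 2 * ennreal C + 2 * (2 * ?ro L + 2 * ?rr L)) \<longlonglongrightarrow> 2 * ennreal C + 2 * (2 * 0 + 2 * 0)"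
    using assms(4,11) unfolding b_def a_def
    by (intro tendsto_add tendsto_const ennreal_tendsto_cmult) simp_all
  then have "D \<le> 2 * ennreal C + 2 * (2 * 0 + 2 * 0)"
    by (rule LIMSEQ_le_const) (use D_le in auto)
  also have "\<dots> = ennreal (2 * C)"
    by (simp add: ennreal_mult')
  finally have "D \<le> ennreal (2 * C)" .
  moreover have "0 \<le> C"
    by (simp add: C_def sum_nonneg)
  \<comment> \<open>\<open>D\<close> is finite, so \<open>L2norm\<close> takes its square-root
    branch.\<close>
  ultimately obtain r where r: "D = ennreal r" "0 \<le> r" "r \<le> 2 * C"
    by (cases D) (auto simp: top_unique)
  have "sqrt r < \<epsilon>"
    using r \<open>2 * C < \<epsilon>\<^sup>2\<close> \<open>\<epsilon> > 0\<close> by (intro real_less_lsqrt) auto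
  then show ?thesis
    using r \<open>\<epsilon> > 0\<close> by (simp add: L2norm_def D_def[symmetric] ennreal_lessI)
qed

end
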